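(* Let $k$ be an odd positive integer such that $5k+2$ is prime, let $m$ be a positive integer greater than $2$, and let $r\in\mathbb{N}$. Then $$F_{m(5k+r)}\equiv F_{mr}F_{3m-1}+5kF_{mr-1}\left(3^{m-1}+\sum_{i=1}^{m-1}3^{m-1-i}F_{3i-1}\right)\pmod{5k+2}.$$
   Context: $(F_n)_{n\ge 0}$ denotes the Fibonacci sequence: $F_0=0$, $F_1=1$, $F_{n+2}=F_{n+1}+F_n$. $\mathbb{N}$ denotes the natural numbers. *)

theory Defs
  imports "HOL-Number_Theory.Number_Theory"
begin

text \<open>
  Fibonacci numbers with integer index, following the standard extension
  \<open>F(-n) = (-1)^(n+1) F(n)\<close>. It is needed because the index \<open>m r - 1\<close> is \<open>-1\<close> for
  \<open>r = 0\<close>, where \<open>F(-1) = 1\<close>; truncated subtraction on \<^typ>\<open>nat\<close> would give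
  \<open>F(0) = 0\<close> instead. On nonnegative indices it is the library's \<^const>\<open>fib\<close>.
\<close>

definition fibz :: "int \<Rightarrow> int" where
  "fibz n = (if n \<ge> 0 then int (fib (nat n))
             else (- 1) ^ (nat (- n) + 1) * int (fib (nat (- n))))"

lemma fibz_of_nat [simp]: "fibz (int n) = int (fib n)"
  by (simp add: fibz_def)

lemma fibz_neg_of_nat: "fibz (- int n) = (- 1) ^ (n + 1) * int (fib n)"
  by (cases "n = 0") (simp_all add: fibz_def)

lemma fibz_minus_1 [simp]: "fibz (- 1) = 1"
  by (simp add: fibz_def)

lemma fibz_rec: "fibz (n + 2) = fibz (n + 1) + fibz n"
proof (cases "n \<ge> 0")
  case True
  then obtain j where "n = int j" by (metis nat_eq_iff)
  then show ?thesis
    using fibz_of_nat[of "j + 2"] fibz_of_nat[of "j + 1"] by (simp add: add.commute)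
next
  case False
  then obtain j where j: "n = - int (Suc j)"
    by (metis int_cases2 neg_0_le_iff_le not0_implies_Suc of_nat_0 of_nat_0_le_iff)
  show ?thesis
  proof (cases j)
    case 0
    then show ?thesis using j fibz_of_nat[of 1] fibz_of_nat[of 0] by simp
  next
    case (Suc i)
    have "n + 1 = - int (Suc i)" "n + 2 = - int i" "n = - int (Suc (Suc i))"
      using j Suc by simp_all
    then show ?thesis by (simp only: fibz_neg_of_nat) (simp add: algebra_simps)
  qed
qed

end

theory Submission
  imports Defs
begin

text \<open>
  Let \<open>\<alpha>\<close>, \<open>\<beta>\<close> be the roots of \<open>x\<^sup>2 = x + 1\<close> and \<open>p = 5 k + 2\<close>. Since \<open>p\<close> is inert in
  the field generated by \<open>\<alpha>\<close>, Frobenius swaps the roots: \<open>\<alpha>\<^sup>p = \<beta>\<close> modulo \<open>p\<close>, that is,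
  \<open>F(p) = -1\<close> and \<open>F(p + 1) = 0\<close>. Elementarily, this is the binomial expansion of
  \<open>(1 + sqrt 5)\<^sup>p\<close> combined with Euler's criterion for \<open>5\<close>. Consequently \<open>\<alpha>\<close> to the power
  \<open>5 k\<close> is \<open>\<beta>\<^sup>3\<close>, so \<open>F(5 k m) = - F(3 m)\<close> and \<open>F(5 k m + 1) = F(3 m - 1)\<close> modulo \<open>p\<close>. The
  theorem follows from the addition formula and the recurrence
  \<open>F(3 m + 3) = 3 F(3 m) + 2 F(3 m - 1)\<close>, which makes the bracketed sum equal to \<open>F(3 m) / 2\<close>.
\<close>

definition binomial_transform :: "(nat \<Rightarrow> 'a) \<Rightarrow> nat \<Rightarrow> 'a::comm_ring_1" where
  "binomial_transform f n = (\<Sum>i\<le>n. of_nat (n choose i) * f i)"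

lemma binomial_transform_0 [simp]: "binomial_transform f 0 = f 0"
  by (simp add: binomial_transform_def)

lemma binomial_transform_Suc:
  "binomial_transform f (Suc n) = binomial_transform f n + binomial_transform (\<lambda>i. f (Suc i)) n"
proof -
  have "binomial_transform f (Suc n)
      = f 0 + (\<Sum>i\<le>n. of_nat (n choose Suc i) * f (Suc i)) + binomial_transform (\<lambda>i. f (Suc i)) n"
    unfolding binomial_transform_def
    by (subst sum.atMost_Suc_shift) (simp add: sum.distrib algebra_simps)
  also have "f 0 + (\<Sum>i\<le>n. of_nat (n choose Suc i) * f (Suc i))
      = (\<Sum>i\<le>Suc n. of_nat (n choose i) * f i)"
    by (subst sum.atMost_Suc_shift) simp
  also have "\<dots> = binomial_transform f n"
    by (simp add: binomial_transform_def binomial_eq_0)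
  finally show ?thesis .
qed

lemma binomial_transform_cmult:
  "binomial_transform (\<lambda>i. c * f i) n = c * binomial_transform f n"
  by (simp add: binomial_transform_def sum_distrib_left mult.left_commute)

text \<open>\<open>p\<close> divides every binomial coefficient with \<open>0 < i < p\<close>, so
  only the two end terms survive. Applied to powers of sqrt 5 this is Frobenius on 1 + sqrt
  5.\<close>

lemma binomial_transform_prime_cong:
  fixes f :: "nat \<Rightarrow> int"
  assumes "prime p"
  shows "[binomial_transform f p = f 0 + f p] (mod int p)"
proof -
  have p: "p > 0" using assms by (simp add: prime_gt_0_nat)
  have "binomial_transform f p
      = f 0 + f p + (\<Sum>i\<in>{0<..<p}. int (p choose i) * f i)"
  proof -
    have "{..p} = insert 0 (insert p {0<..<p})" using p by auto
    then show ?thesis using p by (simp add: binomial_transform_def)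
  qed
  moreover have "int p dvd (\<Sum>i\<in>{0<..<p}. int (p choose i) * f i)"
    using assms by (intro dvd_sum dvd_mult2) (auto intro!: dvd_choose_prime)
  ultimately show ?thesis
    by (simp add: cong_iff_dvd_diff)
qed

text \<open>The rational part and the coefficient of \<open>sqrt 5\<close> of \<open>(sqrt 5)^i\<close>.\<close>

definition sqrt5_rat :: "nat \<Rightarrow> int" where
  "sqrt5_rat i = (if even i then 5 ^ (i div 2) else 0)"

definition sqrt5_irr :: "nat \<Rightarrow> int" where
  "sqrt5_irr i = (if odd i then 5 ^ (i div 2) else 0)"

lemma sqrt5_Suc:
  "sqrt5_rat (Suc i) = 5 * sqrt5_irr i" "sqrt5_irr (Suc i) = sqrt5_rat i"
  by (auto simp: sqrt5_rat_def sqrt5_irr_def elim!: oddE)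

text \<open>Compares components in (1 + sqrt 5)^n = (2 \<alpha>)^n, where 2 \<alpha>^n = L(n) + F(n)
  sqrt 5 with the Lucas number L(n) = 2 F(n+1) - F(n). Multiplying by 1 + sqrt 5 mixes both
  components, hence the joint induction.\<close>

lemma fib_binomial_transform:
  "2 ^ n * int (fib n) = 2 * binomial_transform sqrt5_irr n"
  "2 ^ n * (2 * int (fib (Suc n)) - int (fib n)) = 2 * binomial_transform sqrt5_rat n"
proof (induction n)
  case 0
  {
    case 1
    show ?case by (simp add: sqrt5_irr_def)
  next
    case 2
    show ?case by (simp add: sqrt5_rat_def)
  }
next
  case (Suc n)
  {
    case 1
    show ?case using Suc by (simp add: binomial_transform_Suc sqrt5_Suc algebra_simps)
  next
    case 2
    have "binomial_transform sqrt5_rat (Suc n)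
        = binomial_transform sqrt5_rat n + 5 * binomial_transform sqrt5_irr n"
      by (simp add: binomial_transform_Suc sqrt5_Suc binomial_transform_cmult)
    then show ?case using Suc by (simp add: algebra_simps)
  }
qed

text \<open>The squares modulo 5 are 0, 1, 4, so \<open>p\<close> is a nonresidue modulo 5. Since (5
  - 1)/2 is even, reciprocity carries no sign, and Euler's criterion applies.\<close>

lemma five_power_cong:
  assumes "prime p" "odd p" "p mod 5 = 2"
  shows "[5 ^ ((p - 1) div 2) = - 1] (mod int p)"
proof -
  have p2: "p > 2"
    using assms prime_ge_2_nat[of p] by (cases "p = 2") auto
  have p5: "p \<noteq> 5" using assms by auto
  have "int p mod 5 = 2" using assms by presburger
  then have "\<not> QuadRes 5 (int p)"
  proof -
    have "y ^ 2 mod 5 \<noteq> (2::int)" for y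
    proof -
      have "y mod 5 \<in> {0, 1, 2, 3, 4}" by auto
      then have "(y mod 5) ^ 2 mod 5 \<noteq> (2::int)" by auto
      then show ?thesis by (simp add: power_mod)
    qed
    then show ?thesis using \<open>int p mod 5 = 2\<close> by (auto simp: QuadRes_def cong_def)
  qed
  then have "Legendre (int p) 5 = - 1"
    using \<open>int p mod 5 = 2\<close> by (auto simp: Legendre_def cong_def)
  moreover have "Legendre (int p) (int 5) * Legendre (int 5) (int p)
      = (- 1) ^ ((p - 1) div 2 * ((5 - 1) div 2))"
    using assms p2 p5 by (intro Quadratic_Reciprocity) auto
  ultimately have "Legendre 5 (int p) = - 1"
    by (simp add: minus_one_power_iff)
  then show ?thesis
    using euler_criterion[of p 5] assms p2 by (simp add: cong_sym)
qed

lemma fib_prime_cong: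
  assumes "prime p" "odd p" "p mod 5 = 2"
  shows "[int (fib p) = - 1] (mod int p)" "[int (fib (Suc p)) = 0] (mod int p)"
proof -
  have cop: "coprime 2 (int p)" using assms(2) by simp
  have "\<not> p dvd 2"
    using assms by (metis dvd_imp_le even_numeral le_antisym odd_one pos2 prime_ge_2_nat)
  then have "[2 ^ (p - 1) = 1] (mod p)"
    using fermat_theorem assms(1) by blast
  then have "[int (2 ^ (p - 1)) * 2 = int 1 * 2] (mod int p)"
    by (intro cong_mult) (simp_all only: cong_int_iff cong_refl)
  moreover have "(2::int) ^ p = 2 ^ (p - 1) * 2"
    using assms(1) by (metis power_minus_mult prime_gt_0_nat)
  ultimately have two: "[2 ^ p = 2] (mod int p)" by simp
  \<comment> \<open>By Fermat \<open>2 ^ p\<close> acts as 2, which cancels because \<open>p\<close>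
    is odd.\<close>
  have *: "[x = y] (mod int p)" if "2 ^ p * x = 2 * z" "[z = y] (mod int p)" for x y z :: int
  proof -
    have "[2 * x = 2 ^ p * x] (mod int p)"
      using two by (intro cong_mult) (simp_all add: cong_sym)
    also have "2 ^ p * x = 2 * z" by fact
    also have "[2 * z = 2 * y] (mod int p)" using that by (intro cong_mult) simp_all
    finally show ?thesis using cop cong_mult_lcancel by blast
  qed
  have pd: "(p - 1) div 2 = p div 2" using assms(2) by (auto elim!: oddE)
  \<comment> \<open>As \<open>p\<close> is odd, the irrational part keeps only the end term
    5^((p-1)/2), and the rational part below only the term 1 at index 0.\<close>
  have "[binomial_transform sqrt5_irr p = - 1] (mod int p)"
    using binomial_transform_prime_cong[OF assms(1), of sqrt5_irr] five_power_cong[OF assms] assms pd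
    by (auto simp: sqrt5_irr_def intro: cong_trans)
  then show 1: "[int (fib p) = - 1] (mod int p)"
    using * fib_binomial_transform(1) by blast
  have "[binomial_transform sqrt5_rat p = 1] (mod int p)"
    using binomial_transform_prime_cong[OF assms(1), of sqrt5_rat] assms
    by (simp add: sqrt5_rat_def)
  then have "[2 * int (fib (Suc p)) - int (fib p) = 1] (mod int p)"
    using * fib_binomial_transform(2) by blast
  from cong_add[OF this 1] have "[2 * int (fib (Suc p)) = 2 * 0] (mod int p)" by simp
  then show "[int (fib (Suc p)) = 0] (mod int p)" using cop cong_mult_lcancel by blast
qed

text \<open>The integer index covers \<open>a = 0\<close>, where the coefficient of F(b) must be
  F(-1) = 1.\<close>

lemma fib_add_fibz:
  "int (fib (a + b)) = int (fib a) * int (fib (Suc b)) + fibz (int a - 1) * int (fib b)"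
proof (cases a)
  case (Suc n)
  then show ?thesis using fib_add[of b n] by (simp add: add.commute algebra_simps)
qed simp

text \<open>These are the coordinates of \<alpha>^(5km) = \<beta>^(3m). Carrying two neighbouring
  values lets the addition formula advance the index by \<open>5 * k\<close>.\<close>

lemma fib_mult_cong:
  fixes k m :: nat
  assumes "odd k" "prime (5 * k + 2)"
  shows "[int (fib (5 * k * m)) = - int (fib (3 * m))] (mod int (5 * k + 2)) \<and>
         [int (fib (Suc (5 * k * m))) = fibz (3 * int m - 1)] (mod int (5 * k + 2))"
    (is "[_ = _] (mod ?p) \<and> _")
proof (induction m)
  case 0
  show ?case by simp
next
  case (Suc m)
  define q where "q = 5 * k"
  have p: "?p = int (q + 2)" by (simp add: q_def)
  have f: "[int (fib (q + 2)) = - 1] (mod ?p)" "[int (fib (Suc (q + 2))) = 0] (mod ?p)"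
  proof -
    have "odd (5 * k + 2)" "(5 * k + 2) mod 5 = 2" using assms(1) by simp presburger
    then show "[int (fib (q + 2)) = - 1] (mod ?p)" "[int (fib (Suc (q + 2))) = 0] (mod ?p)"
      using fib_prime_cong[of "5 * k + 2"] assms(2) unfolding q_def by blast+
  qed
  \<comment> \<open>The recurrence is run backwards from F(p+1) and F(p) to F(p-1) and F(p-2), where
    p = \<open>q + 2\<close>.\<close>
  have q1: "[int (fib (Suc q)) = 1] (mod ?p)"
    using cong_diff[OF f(2,1)] by simp
  have q0: "[int (fib q) = - 2] (mod ?p)"
    using cong_diff[OF f(1) q1] by simp
  have fibz_m: "fibz (3 * int m - 1) = int (fib (Suc (3 * m))) - int (fib (3 * m))"
    using fibz_rec[of "3 * int m - 1"] fibz_of_nat[of "3 * m"] fibz_of_nat[of "Suc (3 * m)"]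
    by (simp add: algebra_simps)
  have IH: "[int (fib (q * m)) = - int (fib (3 * m))] (mod ?p)"
    "[int (fib (Suc (q * m))) = int (fib (Suc (3 * m))) - int (fib (3 * m))] (mod ?p)"
    using Suc fibz_m by (simp_all add: q_def)
  have "int (fib (q * Suc m)) = int (fib (q * m + q))" by (simp add: add.commute)
  also have "\<dots> = int (fib (q * m)) * (int (fib (Suc q)) - int (fib q))
      + int (fib (Suc (q * m))) * int (fib q)"
  proof -
    have z: "fibz (int q - 1) = int (fib (Suc q)) - int (fib q)"
      using fibz_rec[of "int q - 1"] fibz_of_nat[of "Suc q"] by (simp add: algebra_simps)
    show ?thesis
      using fib_add_fibz[of q "q * m"] unfolding z by (simp add: algebra_simps)
  qed
  also have "[\<dots> = - int (fib (3 * m)) * (1 - (- 2))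
      + (int (fib (Suc (3 * m))) - int (fib (3 * m))) * (- 2)] (mod ?p)"
    using IH q0 q1 by (intro cong_add cong_mult cong_diff)
  also have "- int (fib (3 * m)) * (1 - (- 2))
      + (int (fib (Suc (3 * m))) - int (fib (3 * m))) * (- 2) = - int (fib (3 * Suc m))"
    by (simp add: numeral_eq_Suc)
  finally have A: "[int (fib (q * Suc m)) = - int (fib (3 * Suc m))] (mod ?p)" .
  have "int (fib (Suc (q * Suc m))) = int (fib (Suc (q * m + q)))" by (simp add: add.commute)
  also have "\<dots> = int (fib (Suc (q * m))) * int (fib (Suc q)) + int (fib (q * m)) * int (fib q)"
    using fib_add[of "q * m" q] by (simp add: algebra_simps)
  also have "[\<dots> = (int (fib (Suc (3 * m))) - int (fib (3 * m))) * 1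
      + - int (fib (3 * m)) * (- 2)] (mod ?p)"
    using IH q0 q1 by (intro cong_add cong_mult)
  also have "(int (fib (Suc (3 * m))) - int (fib (3 * m))) * 1 + - int (fib (3 * m)) * (- 2)
      = fibz (3 * int (Suc m) - 1)"
    using fibz_of_nat[of "3 * m + 2"] by (simp add: algebra_simps)
  finally show ?case using A by (simp add: q_def)
qed

text \<open>Unrolls F(3m+3) = 3 F(3m) + 2 F(3m-1) from F(3) = 2; the start value and every increment
  contribute the common factor 2.\<close>

lemma fib_triple_sum:
  assumes "m \<ge> 1"
  shows "int (fib (3 * m))
       = 2 * (3 ^ (m - 1) + (\<Sum>i = 1..m - 1. 3 ^ (m - 1 - i) * int (fib (3 * i - 1))))"
  using assms
proof (induction m rule: nat_induct_at_least)
  case base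
  show ?case by (simp add: numeral_eq_Suc)
next
  case (Suc m)
  obtain n where n: "m = Suc n" using Suc.hyps by (cases m) auto
  have "(\<Sum>i = 1..m. 3 ^ (m - i) * int (fib (3 * i - 1)))
      = (\<Sum>i = 1..n. 3 ^ (m - i) * int (fib (3 * i - 1))) + int (fib (3 * m - 1))"
    by (simp add: n)
  also have "(\<Sum>i = 1..n. 3 ^ (m - i) * int (fib (3 * i - 1)))
      = 3 * (\<Sum>i = 1..n. 3 ^ (n - i) * int (fib (3 * i - 1)))"
    by (simp add: n sum_distrib_left Suc_diff_le mult.assoc)
  finally have "2 * (3 ^ m + (\<Sum>i = 1..m. 3 ^ (m - i) * int (fib (3 * i - 1))))
      = 3 * int (fib (3 * m)) + 2 * int (fib (3 * m - 1))"
    using Suc.IH by (simp add: n)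
  also have "\<dots> = int (fib (3 * Suc m))"
    by (simp add: n numeral_eq_Suc)
  finally show ?case by simp
qed

theorem theorem3p7:
  fixes k m r :: nat
  assumes "k > 0" and "odd k" and "prime (5 * k + 2)" and "m > 2"
  shows "[int (fib (m * (5 * k + r))) =
          int (fib (m * r)) * int (fib (3 * m - 1)) +
          5 * int k * fibz (int (m * r) - 1) *
            (3 ^ (m - 1) + (\<Sum>i = 1..m - 1. 3 ^ (m - 1 - i) * int (fib (3 * i - 1))))]
         (mod int (5 * k + 2))"
proof -
  define S where
    "S = (3::int) ^ (m - 1) + (\<Sum>i = 1..m - 1. 3 ^ (m - 1 - i) * int (fib (3 * i - 1)))"
  let ?p = "int (5 * k + 2)"
  have S: "int (fib (3 * m)) = 2 * S"
    using fib_triple_sum[of m] assms by (simp add: S_def)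
  have "3 * int m - 1 = int (3 * m - 1)" using assms by simp
  then have z: "fibz (3 * int m - 1) = int (fib (3 * m - 1))" by (simp only: fibz_of_nat)
  have "[int (fib (5 * k * m)) = - int (fib (3 * m))] (mod ?p)"
    using fib_mult_cong assms by blast
  \<comment> \<open>Here -2 is replaced by 5k: the difference -2S - 5kS is -S times the
    modulus.\<close>
  also have "[- int (fib (3 * m)) = 5 * int k * S] (mod ?p)"
    unfolding cong_iff_dvd_diff S by (rule dvdI[of _ _ "- S"]) (simp add: algebra_simps)
  finally have A: "[int (fib (5 * k * m)) = 5 * int k * S] (mod ?p)" .
  have "[int (fib (Suc (5 * k * m))) = int (fib (3 * m - 1))] (mod ?p)"
    using fib_mult_cong[of k m] assms unfolding z by blast
  with A have "[int (fib (m * r)) * int (fib (Suc (5 * k * m)))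
        + fibz (int (m * r) - 1) * int (fib (5 * k * m))
      = int (fib (m * r)) * int (fib (3 * m - 1)) + fibz (int (m * r) - 1) * (5 * int k * S)] (mod ?p)"
    by (intro cong_add cong_mult cong_refl)
  moreover have "m * (5 * k + r) = m * r + 5 * k * m" by (simp add: algebra_simps)
  ultimately show ?thesis
    unfolding S_def[symmetric] by (simp only: fib_add_fibz mult_ac)
qed

end
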